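(* For every even integer $q\ge 6$, there exists a finite simple triangle-free graph $G_q$ with no $2$-factor such that \[ \tau(G_q)=\frac{2q^2-q-2}{q^2+q}=2-\frac{3q+2}{q^2+q}, \] where $\tau(G_q)$ denotes the toughness of $G_q$.
   Context: All graphs are simple. For a graph $G$, $c(G)$ denotes the number of connected components of $G$, and for $S\subseteq V(G)$, $G-S$ denotes the subgraph of $G$ induced on $V(G)\setminus S$. For a real number $t\ge 0$, $G$ is $t$-tough if $|S|\ge t\cdot c(G-S)$ for every $S\subseteq V(G)$ with $c(G-S)\ge 2$. The toughness $\tau(G)$ is the largest real number $t$ for which $G$ is $t$-tough, or $\infty$ if $G$ is complete. A $2$-factor of $G$ is a spanning $2$-regular subgraph of $G$. A graph is triangle-free if it contains no three pairwise adjacent vertices. *)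

theory Defs
  imports Complex_Main "HOL-Library.Extended_Real" "Graph_Theory.Graph_Theory"
begin

text \<open>
  A finite simple graph is, as in the library, a finite symmetric digraph without loops and
  parallel arcs (locales \<open>graph\<close> and \<open>pair_graph\<close>): an edge \<open>uv\<close> is the pair of arcs
  \<open>(u,v)\<close>, \<open>(v,u)\<close>. Subgraphs of a graph are then the subdigraphs that are themselves symmetric.
\<close>

text \<open>
  In a symmetric digraph the strongly connected components are the connected components
  of the undirected graph.
\<close>
definition num_components :: "('a,'b) pre_digraph \<Rightarrow> nat" where
  "num_components G = card (pre_digraph.sccs G)"

definition delete_verts :: "('a,'b) pre_digraph \<Rightarrow> 'a set \<Rightarrow> ('a,'b) pre_digraph" where
  "delete_verts G S = G \<restriction> (verts G - S)"

definition tough :: "real \<Rightarrow> ('a,'b) pre_digraph \<Rightarrow> bool" where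
  "tough t G \<longleftrightarrow>
     (\<forall>S \<subseteq> verts G. num_components (delete_verts G S) \<ge> 2 \<longrightarrow>
        real (card S) \<ge> t * real (num_components (delete_verts G S)))"

text \<open>
  For a finite graph that is not complete the greatest \<open>t\<close> exists: \<open>t = 0\<close> qualifies, and the
  constraints on \<open>t\<close> are finitely many non-strict upper bounds, at least one of which comes from
  deleting all vertices except two non-adjacent ones.
\<close>
definition toughness :: "('a,'b) pre_digraph \<Rightarrow> ereal" where
  "toughness G =
     (if complete_digraph (card (verts G)) G then \<infinity>
      else ereal (GREATEST t. 0 \<le> t \<and> tough t G))"

text \<open>
  Since \<open>H\<close> is symmetric, the out-degree of a vertex is its degree in the undirected graph.
\<close>
definition two_factor :: "('a,'b) pre_digraph \<Rightarrow> ('a,'b) pre_digraph \<Rightarrow> bool" where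
  "two_factor H G \<longleftrightarrow> graph H \<and> spanning H G \<and> (\<forall>v \<in> verts H. out_degree H v = 2)"

text \<open>
  There are no loops, so pairwise adjacent vertices are automatically distinct.
\<close>
definition triangle_free :: "('a,'b) pre_digraph \<Rightarrow> bool" where
  "triangle_free G \<longleftrightarrow>
     \<not> (\<exists>u v w. u \<rightarrow>\<^bsub>G\<^esub> v \<and> v \<rightarrow>\<^bsub>G\<^esub> w \<and> u \<rightarrow>\<^bsub>G\<^esub> w)"

end

theory Submission
  imports Defs "HOL-Library.Countable"
begin

text \<open>
  The graph consists of six disjoint blobs, of \<open>5 N\<close> link vertices with \<open>N\<close> odd, of two hubs
  adjacent to all links, and of \<open>L\<close> leaves. Link number \<open>n\<close> of bundle \<open>i\<close> (\<open>1 \<le> i \<le> 5\<close>) joins blob \<open>i\<close> to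
  the central blob \<open>0\<close>, using a private vertex in each; the leaves are completely joined to \<open>K\<close>
  twins in the central blob.

  There is no 2-factor by Tutte's argument: every blob sends an odd number of edges to the links,
  and a 2-factor uses an even number of them, so it misses at least six of the \<open>10 N\<close> link-blob
  edges. Hence it uses at least six link-hub edges, but the two hubs admit only four.

  A blob is a blow-up of the triangle-free circulant graph on 13 vertices with connection set
  \<open>{\<plusminus>1, \<plusminus>5}\<close> (the Ramsey graph for \<open>R(3,5)\<close>), in which every nonempty independent set \<open>I\<close> has at
  least \<open>2|I| + 1\<close> neighbours. With sufficiently large classes, deleting an entire class therefore
  costs more than twice the number of resulting components plus any given constant. When no class
  is deleted entirely, all blobs stay connected, and a component count along the links shows that
  the only bottleneck is the separation of the leaves by their \<open>K\<close> neighbours, which leaves \<open>L + 1\<close>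
  components. So the toughness is \<open>K / (L + 1)\<close>, where \<open>K\<close> and \<open>L\<close> can be chosen freely below ratio 2.
\<close>

section \<open>Components, toughness and relabelling\<close>

definition live_arcs :: "'a pair_pre_digraph \<Rightarrow> 'a set \<Rightarrow> 'a rel" where
  "live_arcs G X = {(u, v) \<in> parcs G. u \<notin> X \<and> v \<notin> X}"

lemma delete_verts_with_proj:
  assumes "pair_wf_digraph G"
  shows "delete_verts (with_proj G) X = with_proj \<lparr>pverts = pverts G - X, parcs = live_arcs G X\<rparr>"
proof -
  interpret pair_wf_digraph G by fact
  show ?thesis
    by (auto simp: delete_verts_def live_arcs_def induce_subgraph_def with_proj_def
        intro: wellformed')
qed

lemma pair_graph_live_arcs:
  assumes "pair_graph G"
  shows "pair_graph \<lparr>pverts = pverts G - X, parcs = live_arcs G X\<rparr>"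
proof -
  interpret pair_graph G by fact
  show ?thesis
  proof
    show "symmetric (with_proj \<lparr>pverts = pverts G - X, parcs = live_arcs G X\<rparr>)"
      unfolding symmetric_def by (auto simp: live_arcs_def intro!: symI intro: arcs_symmetric)
    have "live_arcs G X \<subseteq> parcs G" by (auto simp: live_arcs_def)
    then show "finite (parcs \<lparr>pverts = pverts G - X, parcs = live_arcs G X\<rparr>)"
      by (simp add: finite_subset[OF _ pair_finite_arcs])
  qed (auto simp: live_arcs_def wellformed' no_loops')
qed

text \<open>Surviving arcs are symmetric, so reachability is an equivalence on the surviving
  vertices and its classes are the strongly connected components. From here on, components are
  handled through the reflexive transitive closure of \<open>live_arcs\<close>.\<close>

lemma num_components_conv:
  assumes "pair_graph G"
  shows "num_components (delete_verts (with_proj G) X) =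
    card ((\<lambda>u. {v \<in> pverts G - X. (u, v) \<in> (live_arcs G X)\<^sup>*}) ` (pverts G - X))"
proof -
  define D where "D = \<lparr>pverts = pverts G - X, parcs = live_arcs G X\<rparr>"
  interpret D: pair_graph D unfolding D_def by (rule pair_graph_live_arcs[OF assms])
  have sym: "sym ((live_arcs G X)\<^sup>*)"
    using D.sym_arcs by (auto simp: symmetric_def D_def intro: sym_rtrancl)
  have reach: "u \<rightarrow>\<^sup>*\<^bsub>with_proj D\<^esub> v \<longleftrightarrow> v \<in> pverts G - X \<and> (u, v) \<in> (live_arcs G X)\<^sup>*"
    if "u \<in> pverts G - X" for u v
    using that D.reachable_conv[of u v] D.reachable_in_verts[of u v]
    by (auto simp: D_def)
  have scc: "D.scc_of u = {v \<in> pverts G - X. (u, v) \<in> (live_arcs G X)\<^sup>*}"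
    if "u \<in> pverts G - X" for u
    unfolding D.scc_of_def using reach that sym by (auto dest: symD)
  have "num_components (delete_verts (with_proj G) X) = card D.sccs"
    using assms by (simp add: num_components_def D_def delete_verts_with_proj pair_graph_def
        pair_digraph_def pair_fin_digraph_def)
  also have "\<dots> = card (D.scc_of ` (pverts G - X))"
    by (simp add: D.card_sccs_verts[symmetric] D.sccs_verts_conv_scc_of) (simp add: D_def)
  also have "D.scc_of ` (pverts G - X) =
    (\<lambda>u. {v \<in> pverts G - X. (u, v) \<in> (live_arcs G X)\<^sup>*}) ` (pverts G - X)"
    using scc by (intro image_cong) auto
  finally show ?thesis .
qed

lemma sym_live_arcs:
  assumes "pair_graph G"
  shows "sym (live_arcs G X)"
proof -
  interpret pair_graph G by fact
  show ?thesis by (auto simp: live_arcs_def intro!: symI intro: arcs_symmetric)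
qed

text \<open>Every component is the class of some element of \<open>P\<close>. Elements of
  \<open>P\<close> may be redundant or lie in \<open>X\<close>; this only weakens the bound, so
  \<open>P\<close> can be chosen generously.\<close>

lemma num_components_le:
  assumes G: "pair_graph G" and "finite P"
    and cover: "\<And>v. v \<in> pverts G - X \<Longrightarrow> \<exists>p\<in>P. (v, p) \<in> (live_arcs G X)\<^sup>*"
  shows "num_components (delete_verts (with_proj G) X) \<le> card P"
proof -
  let ?C = "\<lambda>u. {v \<in> pverts G - X. (u, v) \<in> (live_arcs G X)\<^sup>*}"
  have sym: "sym ((live_arcs G X)\<^sup>*)" using sym_live_arcs[OF G] by (rule sym_rtrancl)
  have "?C ` (pverts G - X) \<subseteq> ?C ` P"
  proof
    fix c assume "c \<in> ?C ` (pverts G - X)"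
    then obtain u where u: "u \<in> pverts G - X" "c = ?C u" by blast
    obtain p where p: "p \<in> P" "(u, p) \<in> (live_arcs G X)\<^sup>*" using cover u(1) by blast
    moreover have "(p, u) \<in> (live_arcs G X)\<^sup>*" using p sym by (blast dest: symD)
    ultimately have "?C u = ?C p" by (auto intro: rtrancl_trans)
    then show "c \<in> ?C ` P" using u p by blast
  qed
  then have "card (?C ` (pverts G - X)) \<le> card P"
    using \<open>finite P\<close> by (meson card_image_le card_mono finite_imageI order_trans)
  then show ?thesis by (simp add: num_components_conv[OF G])
qed

text \<open>An invariant \<open>g\<close> of the live arcs is constant on components, so distinct
  values of \<open>g\<close> witness distinct components.\<close>

lemma num_components_ge:
  assumes G: "pair_graph G"
    and const: "\<And>u v. (u, v) \<in> live_arcs G X \<Longrightarrow> g u = g v"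
  shows "card (g ` (pverts G - X)) \<le> num_components (delete_verts (with_proj G) X)"
proof -
  interpret pair_graph G by fact
  let ?C = "\<lambda>u. {v \<in> pverts G - X. (u, v) \<in> (live_arcs G X)\<^sup>*}"
  have g: "g u = g v" if "(u, v) \<in> (live_arcs G X)\<^sup>*" for u v
    using that by induction (auto simp: const)
  have "g ` (pverts G - X) \<subseteq> (\<lambda>c. g (SOME v. v \<in> c)) ` ?C ` (pverts G - X)"
  proof
    fix y assume "y \<in> g ` (pverts G - X)"
    then obtain u where u: "u \<in> pverts G - X" "y = g u" by blast
    then have "u \<in> ?C u" by blast
    then have "(SOME v. v \<in> ?C u) \<in> ?C u" by (rule someI)
    then have "(u, SOME v. v \<in> ?C u) \<in> (live_arcs G X)\<^sup>*" by simp
    then have "y = g (SOME v. v \<in> ?C u)" unfolding u(2) by (rule g)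
    then show "y \<in> (\<lambda>c. g (SOME v. v \<in> c)) ` ?C ` (pverts G - X)"
      unfolding image_image using u(1) by (rule image_eqI)
  qed
  then have "card (g ` (pverts G - X)) \<le> card (?C ` (pverts G - X))"
    by (rule surj_card_le[rotated]) auto
  then show ?thesis by (simp add: num_components_conv[OF G])
qed

text \<open>Toughness is certified from both sides: \<open>tough t G\<close> shows that
  \<open>t\<close> qualifies, and a single separating set \<open>S\<close> of ratio at most
  \<open>t\<close> excludes every larger value.\<close>

lemma toughness_eqI:
  assumes "\<not> complete_digraph (card (verts G)) G" "0 \<le> t" "tough t G"
    and "S \<subseteq> verts G" "num_components (delete_verts G S) \<ge> 2"
    and "real (card S) \<le> t * real (num_components (delete_verts G S))"
  shows "toughness G = ereal t"
proof -
  have "(GREATEST t. 0 \<le> t \<and> tough t G) = t"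
  proof (rule Greatest_equality)
    fix s assume "0 \<le> s \<and> tough s G"
    then have "s * real (num_components (delete_verts G S)) \<le> real (card S)"
      using assms(4,5) unfolding tough_def by blast
    also note assms(6)
    finally have "s * real (num_components (delete_verts G S)) \<le>
        t * real (num_components (delete_verts G S))" .
    then show "s \<le> t" using assms(5) by simp
  qed (use assms in auto)
  then show ?thesis using assms(1) by (simp add: toughness_def)
qed

text \<open>The pairs \<open>(a, b)\<close> and \<open>(b, a)\<close> are distinct, so the relation
  can be emptied two elements at a time.\<close>

lemma even_card_sym_irrefl:
  assumes "finite r" "sym r" "irrefl r"
  shows "even (card r)"
  using assms
proof (induction "card r" arbitrary: r rule: less_induct)
  case less
  show ?case
  proof (cases "r = {}")
    case False
    then obtain a b where ab: "(a, b) \<in> r" by auto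
    then have ba: "(b, a) \<in> r" "a \<noteq> b"
      using less.prems by (auto dest: symD simp: irrefl_def)
    define r' where "r' = r - {(a, b), (b, a)}"
    have card: "card r = card r' + 2"
    proof -
      have "card {(a, b), (b, a)} \<le> card r" using ab ba less.prems by (intro card_mono) auto
      then show ?thesis using ab ba less.prems by (simp add: r'_def card_Diff_subset)
    qed
    have "finite r'" "irrefl r'" using less.prems by (simp_all add: r'_def irrefl_def)
    moreover have "sym r'"
      unfolding r'_def using less.prems(2) by (intro symI) (auto dest: symD)
    ultimately have "even (card r')" using card by (intro less.hyps) auto
    then show ?thesis using card by simp
  qed simp
qed

section \<open>Transport along an injective relabelling, used to move the graph to vertices in
  \<open>nat\<close>\<close>

definition relabel :: "('a \<Rightarrow> 'b) \<Rightarrow> 'a pair_pre_digraph \<Rightarrow> 'b pair_pre_digraph" where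
  "relabel f G = \<lparr>pverts = f ` pverts G, parcs = map_prod f f ` parcs G\<rparr>"

context
  fixes f :: "'a \<Rightarrow> 'b" and G :: "'a pair_pre_digraph"
  assumes f: "inj f" and G: "pair_graph G"
begin

lemma relabel_arc_iff: "(f u, f v) \<in> parcs (relabel f G) \<longleftrightarrow> (u, v) \<in> parcs G"
  using f by (auto simp: relabel_def dest: injD)

lemma pair_graph_relabel: "pair_graph (relabel f G)"
proof -
  interpret pair_graph G by (rule G)
  show ?thesis
  proof
    show "symmetric (with_proj (relabel f G))"
      unfolding symmetric_def by (auto simp: relabel_def intro!: symI intro: arcs_symmetric)
    show "fst e \<noteq> snd e" if "e \<in> parcs (relabel f G)" for e
      using that no_loops' by (auto simp: relabel_def inj_eq[OF f])
  qed (use wellformed' in \<open>auto simp: relabel_def\<close>)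
qed

lemma triangle_free_relabel:
  assumes "triangle_free (with_proj G)"
  shows "triangle_free (with_proj (relabel f G))"
  using assms unfolding triangle_free_def by (auto simp: relabel_def inj_eq[OF f])

lemma num_components_relabel:
  assumes "S \<subseteq> pverts G"
  shows "num_components (delete_verts (with_proj (relabel f G)) (f ` S)) =
    num_components (delete_verts (with_proj G) S)"
proof -
  define h where "h = \<lparr>iso_verts = f, iso_arcs = map_prod f f, iso_head = snd, iso_tail = fst\<rparr>"
  define D where "D = delete_verts (with_proj G) S"
  interpret G: pair_graph G by (rule G)
  interpret G': pair_graph "relabel f G" by (rule pair_graph_relabel)
  have D: "D = with_proj \<lparr>pverts = pverts G - S, parcs = live_arcs G S\<rparr>"
    unfolding D_def by (rule delete_verts_with_proj[OF G.pair_wf_digraph])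
  interpret D: pair_graph "\<lparr>pverts = pverts G - S, parcs = live_arcs G S\<rparr>"
    by (rule pair_graph_live_arcs[OF G])
  have iso: "pre_digraph.digraph_isomorphism D h"
    using f D.wf_digraph
    by (auto simp: pre_digraph.digraph_isomorphism_def D h_def intro!: inj_onI dest: injD)
  have "live_arcs (relabel f G) (f ` S) = map_prod f f ` live_arcs G S"
    using f by (auto simp: live_arcs_def relabel_def dest: injD)
  moreover have "pverts (relabel f G) - f ` S = f ` (pverts G - S)"
    using f by (auto simp: relabel_def dest: injD)
  ultimately have "delete_verts (with_proj (relabel f G)) (f ` S) = app_iso h D"
    unfolding delete_verts_with_proj[OF G'.pair_wf_digraph]
    by (simp add: D app_iso_def h_def with_proj_def)
  then show ?thesis
    using iso by (simp add: num_components_def D_def)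
qed

lemma toughness_relabel: "toughness (with_proj (relabel f G)) = toughness (with_proj G)"
proof -
  have inj: "inj_on f A" for A using f by (simp add: inj_on_def)
  have verts: "verts (with_proj (relabel f G)) = f ` verts (with_proj G)"
    by (simp add: relabel_def)
  have "tough t (with_proj (relabel f G)) \<longleftrightarrow> tough t (with_proj G)" for t
    unfolding tough_def verts all_subset_image
    by (simp add: num_components_relabel card_image[OF inj])
  moreover have "complete_digraph (card (verts (with_proj (relabel f G)))) (with_proj (relabel f G)) \<longleftrightarrow>
    complete_digraph (card (verts (with_proj G))) (with_proj G)"
  proof -
    interpret G: pair_graph G by (rule G)
    have "parcs (relabel f G) = {(u, v) \<in> f ` pverts G \<times> f ` pverts G. u \<noteq> v} \<longleftrightarrow>
        map_prod f f ` parcs G = map_prod f f ` {(u, v) \<in> pverts G \<times> pverts G. u \<noteq> v}"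
      using f by (intro arg_cong2[where f = "(=)"]) (auto simp: relabel_def dest: injD)
    also have "\<dots> \<longleftrightarrow> parcs G = {(u, v) \<in> pverts G \<times> pverts G. u \<noteq> v}"
      by (rule inj_image_eq_iff[OF prod.inj_map[OF f f]])
    finally show ?thesis
      using G.finite_verts by (simp add: complete_digraph_pair_def relabel_def)
  qed
  ultimately show ?thesis by (simp add: toughness_def)
qed

end

text \<open>Reduces a 2-factor to a plain symmetric relation: as a subgraph it inherits
  \<open>fst\<close> and \<open>snd\<close> as tail and head, so the out-degree of \<open>v\<close>
  is the size of its image under the arc relation.\<close>

lemma two_factor_arcs:
  assumes "two_factor H (with_proj G)"
  shows "arcs H \<subseteq> parcs G" "sym (arcs H)" "\<And>v. v \<in> pverts G \<Longrightarrow> card (arcs H `` {v}) = 2"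
proof -
  from assms interpret H: graph H by (simp add: two_factor_def)
  from assms have sub: "arcs H \<subseteq> parcs G" "verts H = pverts G" "tail H = fst" "head H = snd"
    by (auto simp: two_factor_def spanning_def subgraph_def compatible_def)
  show "arcs H \<subseteq> parcs G" by fact
  show "sym (arcs H)"
    using H.sym_arcs sub by (simp add: symmetric_def arcs_ends_conv)
  show "card (arcs H `` {v}) = 2" if "v \<in> pverts G" for v
  proof -
    have "arcs H `` {v} = snd ` out_arcs H v"
      using sub by (force simp: out_arcs_def)
    moreover have "inj_on snd (out_arcs H v)"
      using sub by (auto simp: out_arcs_def inj_on_def)
    ultimately show ?thesis
      using assms that sub by (simp add: two_factor_def out_degree_def card_image)
  qed
qed

section \<open>Neighbourhoods of independent sets in a circulant graph\<close>

text \<open>For representatives in \<open>{0..<13}\<close>, the distances 8 and 12 are the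
  differences 5 and 1 taken the other way round modulo 13.\<close>

definition circ :: "int \<Rightarrow> int \<Rightarrow> bool" where
  "circ c d \<longleftrightarrow> (let r = \<bar>c - d\<bar> in r = 1 \<or> r = 5 \<or> r = 8 \<or> r = 12)"

lemma circ_sym: "circ c d \<Longrightarrow> circ d c"
  by (simp add: circ_def abs_minus_commute)

lemma circ_irrefl: "\<not> circ c c"
  by (simp add: circ_def)

text \<open>The residues \<plusminus>1, \<plusminus>5 form a sum-free set modulo 13: two of them add
  up to 0, \<plusminus>2, \<plusminus>3, \<plusminus>4 or \<plusminus>6.\<close>

lemma circ_triangle_free:
  assumes "circ c d" "circ d e" 
  shows "\<not> circ c e"
  using assms unfolding circ_def Let_def by arith

text \<open>Independent sets are enumerated as lists so that the expansion property becomes a finite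
  evaluation.\<close>

fun prepend_indep :: "int \<Rightarrow> int list list \<Rightarrow> int list list" where
  "prepend_indep v [] = []"
| "prepend_indep v (xs # xss) =
     (if list_ex (circ v) xs then prepend_indep v xss else (v # xs) # prepend_indep v xss)"

fun indep_lists :: "int list \<Rightarrow> int list list" where
  "indep_lists [] = [[]]"
| "indep_lists (v # vs) = (let xss = indep_lists vs in prepend_indep v xss @ xss)"

lemma set_prepend_indep:
  "set (prepend_indep v xss) = {v # xs | xs. xs \<in> set xss \<and> (\<forall>u\<in>set xs. \<not> circ v u)}"
  by (induction xss) (auto simp: list_ex_iff)

lemma indep_lists_complete:
  assumes "distinct vs" "I \<subseteq> set vs" "\<And>c d. c \<in> I \<Longrightarrow> d \<in> I \<Longrightarrow> \<not> circ c d"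
  shows "\<exists>xs \<in> set (indep_lists vs). set xs = I \<and> distinct xs"
  using assms
proof (induction vs arbitrary: I)
  case (Cons v vs)
  from Cons.prems have "\<exists>xs \<in> set (indep_lists vs). set xs = I - {v} \<and> distinct xs"
    by (intro Cons.IH) auto
  then obtain xs where xs: "xs \<in> set (indep_lists vs)" "set xs = I - {v}" "distinct xs"
    by blast
  show ?case
  proof (cases "v \<in> I")
    case True
    then have "v # xs \<in> set (indep_lists (v # vs))"
      using xs Cons.prems(3) by (auto simp: set_prepend_indep Let_def)
    moreover have "set (v # xs) = I" "distinct (v # xs)"
      using xs True by auto
    ultimately show ?thesis by blast
  next
    case False
    then show ?thesis using xs by (intro bexI[of _ xs]) (auto simp: Let_def)
  qed
qed auto

text \<open>Checked by evaluating all independent sets. The empty one is exempt because it has no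
  neighbours.\<close>

lemma indep_lists_expand:
  "list_all (\<lambda>xs. xs = [] \<or>
     2 * length xs + 1 \<le> length (filter (\<lambda>d. list_ex (\<lambda>c. circ c d) xs)
       [0,1,2,3,4,5,6,7,8,9,10,11,12]))
   (indep_lists [0,1,2,3,4,5,6,7,8,9,10,11,12])"
  by code_simp

lemma atLeastLessThan_13: "{0..<13::int} = set [0,1,2,3,4,5,6,7,8,9,10,11,12]"
  by (auto; presburger)

lemma circ_expand:
  assumes "I \<subseteq> {0..<13}" "I \<noteq> {}" "\<And>c d. c \<in> I \<Longrightarrow> d \<in> I \<Longrightarrow> \<not> circ c d"
  shows "2 * card I + 1 \<le> card {d \<in> {0..<13}. \<exists>c\<in>I. circ c d}"
proof -
  define vs :: "int list" where "vs = [0,1,2,3,4,5,6,7,8,9,10,11,12]"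
  have vs: "distinct vs" "set vs = {0..<13}"
    by (simp_all add: vs_def atLeastLessThan_13)
  obtain xs where xs: "xs \<in> set (indep_lists vs)" "set xs = I" "distinct xs"
    using indep_lists_complete[of vs I] assms vs by blast
  let ?ys = "filter (\<lambda>d. list_ex (\<lambda>c. circ c d) xs) vs"
  have "xs = [] \<or> 2 * length xs + 1 \<le> length ?ys"
    using indep_lists_expand xs(1) unfolding vs_def[symmetric] list_all_iff by blast
  then have "2 * length xs + 1 \<le> length ?ys" using xs assms(2) by auto
  moreover have "length xs = card I" using xs distinct_card by fastforce
  moreover have "length ?ys = card (set ?ys)" using vs by (subst distinct_card) auto
  moreover have "set ?ys = {d \<in> {0..<13}. \<exists>c\<in>I. circ c d}"
    using xs vs by (auto simp: list_ex_iff)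
  ultimately show ?thesis by metis
qed

section \<open>The construction\<close>

text \<open>
  In \<open>Blob i c j\<close>, \<open>c\<close> is a vertex of the circulant graph and \<open>j\<close> numbers its twins.
\<close>
datatype vertex = Blob nat int nat | Link nat nat | Hub nat | Leaf nat

instance vertex :: countable
  by countable_datatype

text \<open>Each kind of edge is given in one direction and symmetrised in the graph. Link
  \<open>n\<close> of bundle \<open>i\<close> attaches to twin \<open>n\<close> of class
  \<open>i\<close>, both in blob \<open>0\<close> and in blob \<open>i\<close>. Class
  \<open>0\<close> of blob \<open>0\<close> is thus free of links, and its first \<open>K\<close>
  twins serve the leaves.\<close>

fun arrow :: "nat \<Rightarrow> vertex \<Rightarrow> vertex \<Rightarrow> bool" where
  "arrow K (Blob i c j) (Blob i' c' j') \<longleftrightarrow> i = i' \<and> circ c c'"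
| "arrow K (Link i n) (Blob i' c j) \<longleftrightarrow> (i' = 0 \<or> i' = i) \<and> c = int i \<and> j = n"
| "arrow K (Link i n) (Hub m) \<longleftrightarrow> True"
| "arrow K (Leaf m) (Blob i c j) \<longleftrightarrow> i = 0 \<and> c = 0 \<and> j < K"
| "arrow K u v \<longleftrightarrow> False"

text \<open>\<open>N\<close> is odd for the parity argument, and \<open>N_ge\<close> makes cutting a
  whole bundle expensive. \<open>K_le\<close> and \<open>N_le\<close> provide enough twins to attach
  to, and \<open>b_ge\<close> lets one fully deleted class pay for all additive losses.
  \<open>ratio\<close> says that K / (L + 1) is at most 2 - 2 / N.\<close>

locale gadget =
  fixes N K L b :: nat
  assumes N_odd: "odd N" and N_ge: "14 \<le> N" and K_le: "K \<le> b" and N_le: "N \<le> b"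
    and b_ge: "2 * (5 * N + L + 21) \<le> b"
    and L_less: "L < K" and ratio: "2 * (L + 1) + K * N \<le> 2 * (L + 1) * N"
begin

definition blob :: "nat \<Rightarrow> vertex set" where
  "blob i = {Blob i c j | c j. c \<in> {0..<13} \<and> j < b}"

definition links :: "vertex set" where
  "links = {Link i n | i n. 1 \<le> i \<and> i \<le> 5 \<and> n < N}"

definition hubs :: "vertex set" where
  "hubs = {Hub 0, Hub 1}"

definition leaves :: "vertex set" where
  "leaves = Leaf ` {..<L}"

definition V :: "vertex set" where
  "V = (\<Union>i<6. blob i) \<union> links \<union> hubs \<union> leaves"

definition G :: "vertex pair_pre_digraph" where
  "G = \<lparr>pverts = V, parcs = {(u, v) \<in> V \<times> V. arrow K u v \<or> arrow K v u}\<rparr>"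

definition bottleneck :: "vertex set" where
  "bottleneck = Blob 0 0 ` {..<K}"

lemma blob_eq: "blob i = (\<lambda>(c, j). Blob i c j) ` ({0..<13} \<times> {..<b})"
  by (auto simp: blob_def)

lemma finite_blob: "finite (blob i)"
  by (simp add: blob_eq)

lemma links_eq: "links = (\<lambda>(i, n). Link i n) ` ({1..5} \<times> {..<N})"
  by (auto simp: links_def)

lemma finite_links: "finite links" and card_links: "card links = 5 * N"
  by (simp_all add: links_eq card_image inj_on_def)

lemma finite_leaves: "finite leaves" and card_leaves: "card leaves = L"
  by (simp_all add: leaves_def card_image inj_on_def)

lemma finite_V: "finite V"
  by (simp add: V_def finite_blob finite_links finite_leaves hubs_def)

lemma pverts_G: "pverts G = V"
  by (simp add: G_def)

lemma in_V [simp]: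
  "Blob i c j \<in> V \<longleftrightarrow> i < 6 \<and> 0 \<le> c \<and> c < 13 \<and> j < b"
  "Link i n \<in> V \<longleftrightarrow> 1 \<le> i \<and> i \<le> 5 \<and> n < N"
  "Hub m \<in> V \<longleftrightarrow> m < 2"
  "Leaf m \<in> V \<longleftrightarrow> m < L"
  by (auto simp: V_def blob_def links_def hubs_def leaves_def)

lemma arc_iff: "(u, v) \<in> parcs G \<longleftrightarrow> u \<in> V \<and> v \<in> V \<and> (arrow K u v \<or> arrow K v u)"
  by (simp add: G_def)

lemma arrow_irrefl: "\<not> arrow K u u"
  by (cases u) (auto simp: circ_irrefl)

lemma pair_graph_G: "pair_graph G"
proof
  have "parcs G \<subseteq> V \<times> V" by (auto simp: G_def)
  then show "finite (parcs G)" using finite_V by (simp add: finite_subset)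
  show "symmetric (with_proj G)"
    unfolding symmetric_def by (auto simp: arc_iff intro!: symI)
  show "fst e \<noteq> snd e" if "e \<in> parcs G" for e
    using that by (auto simp: G_def arrow_irrefl)
qed (auto simp: G_def finite_V)

text \<open>Inside a blob a triangle would project to the circulant graph. Other vertices have
  independent neighbourhoods: the two blob neighbours of a link lie in different blobs, hubs are
  adjacent to links only, and the neighbours of a leaf are twins.\<close>

lemma triangle_free_G: "triangle_free (with_proj G)"
proof -
  have blob: "arrow K (Blob i c j) (Blob i' c' j') \<or> arrow K (Blob i' c' j') (Blob i c j) \<longleftrightarrow>
      i = i' \<and> circ c c'" for i c j i' c' j'
    using circ_sym by auto
  have "False" if "(u, v) \<in> parcs G" "(v, w) \<in> parcs G" "(u, w) \<in> parcs G" for u v w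
    using that unfolding arc_iff
    by (cases u; cases v; cases w)
      (auto simp del: arrow.simps(1) simp: blob circ_irrefl dest: circ_triangle_free)
  then show ?thesis unfolding triangle_free_def by auto
qed

lemma not_complete_G: "\<not> complete_digraph n (with_proj G)"
proof
  assume "complete_digraph n (with_proj G)"
  then have "parcs G = {(u, v). (u, v) \<in> V \<times> V \<and> u \<noteq> v}"
    by (simp add: complete_digraph_pair_def pverts_G)
  moreover have "(Hub 0, Hub 1) \<notin> parcs G" by (simp add: arc_iff)
  ultimately show False by auto
qed

section \<open>Absence of a 2-factor\<close>

lemma no_two_factor_G:
  assumes sub: "F \<subseteq> parcs G" and "sym F" and deg: "\<And>v. v \<in> V \<Longrightarrow> card (F `` {v}) = 2"
  shows False
proof -
  \<comment> \<open>Arcs are counted, so an edge inside \<open>A\<close> contributes 2 to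
    \<open>e A A\<close>.\<close>
  define e where "e A B = card (F \<inter> A \<times> B)" for A B
  have "finite (parcs G)"
    using pair_graph_G by (simp add: pair_graph_def pair_digraph_def pair_fin_digraph_def
        pair_fin_digraph_axioms_def)
  then have fin: "finite F" using sub finite_subset by blast
  have F: "u \<in> V" "v \<in> V" "arrow K u v \<or> arrow K v u" "u \<noteq> v" if "(u, v) \<in> F" for u v
    using that sub arrow_irrefl by (auto simp: arc_iff)
  have e_Un: "e A (B \<union> C) = e A B + e A C" if "B \<inter> C = {}" for A B C
  proof -
    have "F \<inter> A \<times> (B \<union> C) = (F \<inter> A \<times> B) \<union> (F \<inter> A \<times> C)" by blast
    then show ?thesis unfolding e_def using fin that by (auto intro: card_Un_disjoint)
  qed
  have e_Un': "e (B \<union> C) A = e B A + e C A" if "B \<inter> C = {}" for A B C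
  proof -
    have "F \<inter> (B \<union> C) \<times> A = (F \<inter> B \<times> A) \<union> (F \<inter> C \<times> A)" by blast
    then show ?thesis unfolding e_def using fin that by (auto intro: card_Un_disjoint)
  qed
  have e_comm: "e A B = e B A" for A B
  proof -
    have "F \<inter> B \<times> A = prod.swap ` (F \<inter> A \<times> B)"
      using \<open>sym F\<close> by (auto dest: symD)
    then show ?thesis by (simp add: e_def card_image)
  qed
  have e_V: "e A V = 2 * card A" if "A \<subseteq> V" for A
  proof -
    have "F \<inter> A \<times> V = Sigma A (\<lambda>v. F `` {v})" using F by auto
    moreover have "card (Sigma A (\<lambda>v. F `` {v})) = (\<Sum>v\<in>A. card (F `` {v}))"
      using that fin finite_V by (intro card_SigmaI) (auto intro: finite_subset)
    moreover have "\<dots> = (\<Sum>v\<in>A. 2)" using that deg by (intro sum.cong) auto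
    ultimately show ?thesis by (simp add: e_def)
  qed
  \<comment> \<open>Leaves have all their neighbours in blob \<open>0\<close>. Once they are merged
    into it, only links remain as outside neighbours of each \<open>W i\<close>.\<close>
  define W where "W i = blob i \<union> (if i = 0 then leaves else {})" for i :: nat
  have even_W: "even (e (W i) links)" if "i < 6" for i
  proof -
    have W: "W i \<subseteq> V" using that by (auto simp: W_def V_def)
    have "F \<inter> W i \<times> V = F \<inter> W i \<times> (W i \<union> links)"
    proof -
      have "v \<in> W i \<union> links" if "(u, v) \<in> F" "u \<in> W i" for u v
        using F[OF that(1)] that(2)
        by (cases u; cases v) (auto simp: W_def blob_def leaves_def links_def split: if_splits)
      moreover have "W i \<union> links \<subseteq> V" using W by (auto simp: V_def)
      ultimately show ?thesis by blast
    qed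
    \<comment> \<open>The degrees in \<open>W i\<close> add up to an even number, and the arcs
      inside \<open>W i\<close> come in opposite pairs; what is left for the links is therefore
      even.\<close>
    then have "e (W i) (W i \<union> links) = 2 * card (W i)"
      using e_V[OF W] by (simp add: e_def)
    moreover have "W i \<inter> links = {}"
      by (auto simp: W_def blob_def leaves_def links_def)
    moreover have "even (e (W i) (W i))"
      unfolding e_def
    proof (rule even_card_sym_irrefl)
      show "irrefl (F \<inter> W i \<times> W i)" using F(4) by (blast intro: irreflI)
    qed (use fin \<open>sym F\<close> in \<open>auto intro!: symI dest: symD\<close>)
    ultimately show ?thesis by (simp add: e_Un) (metis dvd_triv_left even_add)
  qed
  have le: "e (W i) links \<le> card A"
    if "finite A" "\<And>u v. u \<in> W i \<Longrightarrow> v \<in> links \<Longrightarrow> arrow K v u \<Longrightarrow> (u, v) \<in> A" for i A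
  proof -
    have "F \<inter> W i \<times> links \<subseteq> A"
    proof
      fix p assume p: "p \<in> F \<inter> W i \<times> links"
      obtain u v where uv: "p = (u, v)" by (cases p)
      have "\<not> arrow K u v" using p uv by (cases u) (auto simp: links_def W_def blob_def leaves_def split: if_splits)
      then show "p \<in> A" using p uv F[of u v] that(2) by auto
    qed
    then show ?thesis unfolding e_def using that(1) by (intro card_mono)
  qed
  have "e (W 0) links \<le> card ((\<lambda>(i, n). (Blob 0 (int i) n, Link i n)) ` ({1..5} \<times> {..<N}))"
    by (intro le) (force simp: W_def blob_def leaves_def links_def)+
  also have "\<dots> = 5 * N"
    by (subst card_image) (auto simp: inj_on_def)
  finally have "e (W 0) links \<noteq> 5 * N \<Longrightarrow> e (W 0) links < 5 * N" by simp
  \<comment> \<open>\<open>5 * N\<close> is odd, so the even count cannot attain this bound;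
    likewise for \<open>N\<close> in the outer blobs.\<close>
  then have W0: "e (W 0) links < 5 * N" using even_W[of 0] N_odd by fastforce
  have Wi: "e (W i) links < N" if "1 \<le> i" "i < 6" for i
  proof -
    have "e (W i) links \<le> card ((\<lambda>n. (Blob i (int i) n, Link i n)) ` {..<N})"
      using that by (intro le) (force simp: W_def blob_def leaves_def links_def)+
    also have "\<dots> = N"
      by (subst card_image) (auto simp: inj_on_def)
    finally have "e (W i) links \<noteq> N \<Longrightarrow> e (W i) links < N" by simp
    then show ?thesis using even_W[of i] that N_odd by fastforce
  qed
  have hubs: "e hubs links \<le> 4"
  proof -
    have "e hubs links \<le> e hubs V"
      unfolding e_def using fin by (intro card_mono) (auto simp: V_def)
    also have "\<dots> = 4" by (subst e_V) (auto simp: hubs_def)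
    finally show ?thesis .
  qed
  have "F \<inter> V \<times> links = F \<inter> (W 0 \<union> (W 1 \<union> (W 2 \<union> (W 3 \<union> (W 4 \<union> (W 5 \<union> hubs)))))) \<times> links"
  proof -
    have "u \<in> W 0 \<union> (W 1 \<union> (W 2 \<union> (W 3 \<union> (W 4 \<union> (W 5 \<union> hubs)))))"
      if "(u, v) \<in> F" "v \<in> links" for u v
    proof -
      have "u \<notin> links" using F[OF that(1)] that(2) by (auto simp: links_def)
      then have "u \<in> (\<Union>i<6. blob i) \<union> hubs \<union> leaves"
        using F(1)[OF that(1)] by (auto simp: V_def)
      moreover have "{..<6} = {0, 1, 2, 3, 4, 5 :: nat}" by auto
      ultimately show ?thesis by (auto simp: W_def)
    qed
    then show ?thesis using F(1) by blast
  qed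
  then have eV: "e V links = e (W 0 \<union> (W 1 \<union> (W 2 \<union> (W 3 \<union> (W 4 \<union> (W 5 \<union> hubs)))))) links"
    by (simp add: e_def)
  have "links \<subseteq> V" by (auto simp: V_def)
  \<comment> \<open>The links need \<open>10 * N\<close> arcs, but the seven parts supply at most (5
    N - 1) + 5 (N - 1) + 4 = 10 N - 2.\<close>
  then have "10 * N = e links V" by (simp add: e_V card_links)
  also have "\<dots> = e V links" by (rule e_comm)
  also note eV
  also have "e (W 0 \<union> (W 1 \<union> (W 2 \<union> (W 3 \<union> (W 4 \<union> (W 5 \<union> hubs)))))) links = e (W 0) links + (e (W 1) links + (e (W 2) links + (e (W 3) links
      + (e (W 4) links + (e (W 5) links + e hubs links)))))"
    by (subst e_Un', force simp: W_def blob_def leaves_def hubs_def)+ simp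
  finally show False
    using W0 Wi[of 1] Wi[of 2] Wi[of 3] Wi[of 4] Wi[of 5] hubs by simp
qed

section \<open>Toughness of the construction\<close>

context
  fixes X :: "vertex set"
  assumes X: "X \<subseteq> V"
begin

abbreviation conn :: "vertex \<Rightarrow> vertex \<Rightarrow> bool" where
  "conn u v \<equiv> (u, v) \<in> (live_arcs G X)\<^sup>*"

section \<open>Deletion of entire classes of a blob\<close>

definition dead :: "nat \<Rightarrow> int set" where
  "dead i = {c \<in> {0..<13}. \<forall>j<b. Blob i c j \<in> X}"

text \<open>The remaining vertices of these classes become singletons when the blob is taken by itself.\<close>
definition isolated :: "nat \<Rightarrow> int set" where
  "isolated i = {c \<in> {0..<13} - dead i. \<forall>d\<in>{0..<13}. circ c d \<longrightarrow> d \<in> dead i}"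

text \<open>A surviving vertex of the class; meaningful only if the class is not dead.\<close>

definition rep :: "nat \<Rightarrow> int \<Rightarrow> vertex" where
  "rep i c = Blob i c (SOME j. j < b \<and> Blob i c j \<notin> X)"

lemma finite_X: "finite X"
  using X finite_V finite_subset by blast

lemma live_arcs_iff:
  "(u, v) \<in> live_arcs G X \<longleftrightarrow> u \<in> V - X \<and> v \<in> V - X \<and> (arrow K u v \<or> arrow K v u)"
  by (auto simp: live_arcs_def arc_iff)

lemma conn_arrow:
  "u \<in> V - X \<Longrightarrow> v \<in> V - X \<Longrightarrow> arrow K u v \<or> arrow K v u \<Longrightarrow> conn u v"
  by (auto simp: live_arcs_iff)

lemma conn_sym: "conn u v \<Longrightarrow> conn v u"
  using sym_live_arcs[OF pair_graph_G] by (meson sym_rtrancl symD)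

lemma rep_live:
  assumes "i < 6" "c \<in> {0..<13} - dead i"
  shows "\<exists>j. rep i c = Blob i c j \<and> rep i c \<in> V - X"
proof -
  have "\<exists>j. j < b \<and> Blob i c j \<notin> X" using assms by (auto simp: dead_def)
  then have "(SOME j. j < b \<and> Blob i c j \<notin> X) < b \<and> Blob i c (SOME j. j < b \<and> Blob i c j \<notin> X) \<notin> X"
    by (rule someI_ex)
  then show ?thesis using assms by (auto simp: rep_def)
qed

lemma conn_rep:
  assumes "Blob i c j \<in> V - X" "d \<in> {0..<13} - dead i" "circ c d"
  shows "conn (Blob i c j) (rep i d)"
proof -
  have "i < 6" using assms by simp
  then obtain j' where "rep i d = Blob i d j'" "rep i d \<in> V - X"
    using rep_live assms(2) by blast
  then show ?thesis using assms by (intro conn_arrow) auto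
qed

lemma finite_dead: "finite (dead i)"
  by (rule finite_subset[of _ "{0..<13}"]) (auto simp: dead_def)

text \<open>Isolated classes are themselves not dead but have only dead neighbours. So they form an
  independent set whose neighbourhood lies in \<open>dead i\<close>, and the expansion of the
  circulant applies.\<close>

lemma card_dead_isolated:
  assumes "dead i \<noteq> {}"
  shows "2 * card (isolated i) + 1 \<le> card (dead i)"
proof (cases "isolated i = {}")
  case True
  then show ?thesis using assms finite_dead by (simp add: Suc_le_eq card_gt_0_iff)
next
  case False
  have "2 * card (isolated i) + 1 \<le> card {d \<in> {0..<13}. \<exists>c\<in>isolated i. circ c d}"
    using False by (intro circ_expand) (auto simp: isolated_def)
  also have "\<dots> \<le> card (dead i)"
    using finite_dead by (intro card_mono) (auto simp: isolated_def)
  finally show ?thesis .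
qed

lemma card_X_blob: "b * card (dead i) \<le> card (X \<inter> blob i)"
proof -
  have "card ((\<lambda>(c, j). Blob i c j) ` (dead i \<times> {..<b})) \<le> card (X \<inter> blob i)"
    using finite_blob by (intro card_mono) (auto simp: dead_def blob_def)
  moreover have "card ((\<lambda>(c, j). Blob i c j) ` (dead i \<times> {..<b})) = b * card (dead i)"
    by (subst card_image) (auto simp: inj_on_def card_cartesian_product)
  ultimately show ?thesis by simp
qed

text \<open>Consecutive classes are adjacent, so the representatives form a path down to class
  \<open>0\<close>.\<close>

lemma conn_rep_0:
  assumes "i < 6" "dead i = {}" "Blob i c j \<in> V - X"
  shows "conn (Blob i c j) (rep i 0)"
proof -
  have rep: "conn (rep i (int n)) (rep i 0)" if "n < 13" for n
    using that
  proof (induction n)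
    case (Suc n)
    have "rep i (int (Suc n)) \<in> V - X"
      using rep_live[of i "int (Suc n)"] assms Suc.prems by auto
    then have "conn (rep i (int (Suc n))) (rep i (int n))"
      unfolding rep_def[of i "int (Suc n)"] using assms Suc.prems
      by (intro conn_rep) (auto simp: circ_def)
    then show ?case using Suc by simp
  qed simp
  \<comment> \<open>Twins are not adjacent, so the vertex enters the path through a neighbouring
    class.\<close>
  define d where "d = (if c = 0 then 1 else c - 1)"
  have d: "d \<in> {0..<13}" "circ c d" using assms(3) by (auto simp: d_def circ_def)
  then have "conn (Blob i c j) (rep i d)" using assms by (intro conn_rep) auto
  also have "conn (rep i d) (rep i 0)" using rep[of "nat d"] d by (simp add: nat_less_iff)
  finally show ?thesis .
qed

text \<open>In a blob with a dead class, the deletions exceed twice the pieces by a surplus of order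
  \<open>b\<close>, which absorbs everything else even if all links, hubs and leaves become separate
  components.\<close>

lemma card_ge_if_dead:
  assumes "i\<^sub>0 < 6" "dead i\<^sub>0 \<noteq> {}"
  shows "2 * num_components (delete_verts (with_proj G) X) \<le> card X"
proof -
  define P where "P i = (if dead i = {} then {rep i 0}
    else (\<lambda>(c, j). Blob i c j) ` (isolated i \<times> {..<b}) \<union> rep i ` {0..<13})" for i
  have fin_iso: "finite (isolated i)" for i
    by (rule finite_subset[of _ "{0..<13}"]) (auto simp: isolated_def)
  then have fin: "finite (P i)" for i by (simp add: P_def)
  \<comment> \<open>With k isolated classes there are at most b k + 13 pieces against at least b (2
    k + 1) deletions, which leaves the surplus \<open>b - 26\<close>. The \<open>+ 2\<close> allows
    an intact blob its single component.\<close>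
  have card_P: "2 * card (P i) + (if dead i = {} then 0 else b - 26) \<le> card (X \<inter> blob i) + 2" for i
  proof (cases "dead i = {}")
    case False
    have "card ((\<lambda>(c, j). Blob i c j) ` (isolated i \<times> {..<b})) = b * card (isolated i)"
      by (subst card_image) (auto simp: inj_on_def card_cartesian_product)
    moreover have "card (rep i ` {0..<13}) \<le> 13"
      using card_image_le[of "{0..<13::int}" "rep i"] by simp
    ultimately have "card (P i) \<le> b * card (isolated i) + 13"
      using False card_Un_le[of "(\<lambda>(c, j). Blob i c j) ` (isolated i \<times> {..<b})" "rep i ` {0..<13}"]
      by (simp add: P_def)
    then have "2 * card (P i) + (b - 26) \<le> b * (2 * card (isolated i) + 1)"
      using b_ge by (simp add: algebra_simps)
    also have "\<dots> \<le> b * card (dead i)"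
      using card_dead_isolated[OF False] by (intro mult_le_mono2)
    also have "\<dots> \<le> card (X \<inter> blob i)" by (rule card_X_blob)
    finally show ?thesis using False by simp
  qed (simp add: P_def)
  define Q where "Q = (\<Union>i<6. P i) \<union> (links \<union> (hubs \<union> leaves))"
  have "num_components (delete_verts (with_proj G) X) \<le> card Q"
  proof (rule num_components_le[OF pair_graph_G])
    show "finite Q" using fin finite_links finite_leaves by (simp add: Q_def hubs_def)
    fix v assume v: "v \<in> pverts G - X"
    show "\<exists>p\<in>Q. conn v p"
    proof (cases v)
      case (Blob i c j)
      then have i: "i < 6" and c: "c \<in> {0..<13} - dead i" and j: "j < b"
        using v by (auto simp: pverts_G dead_def)
      have "\<exists>p\<in>P i. conn v p"
      proof (cases "dead i = {}")
        case True
        then show ?thesis using conn_rep_0[of i c j] i v Blob by (simp add: P_def pverts_G)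
      next
        case dead: False
        show ?thesis
        proof (cases "c \<in> isolated i")
          case True
          then have "v \<in> P i" using dead j Blob by (auto simp: P_def)
          then show ?thesis by blast
        next
          case False
          then obtain d where d: "d \<in> {0..<13} - dead i" "circ c d"
            using c by (auto simp: isolated_def)
          \<comment> \<open>\<open>v\<close> and \<open>rep i c\<close> are twins, joined through a
            surviving neighbouring class \<open>d\<close>.\<close>
          have "conn v (rep i d)" using conn_rep d v Blob by (simp add: pverts_G)
          also obtain j' where "rep i c = Blob i c j'" "rep i c \<in> V - X"
            using rep_live i c by blast
          then have "conn (rep i c) (rep i d)" using conn_rep d by metis
          then have "conn (rep i d) (rep i c)" by (rule conn_sym)
          finally show ?thesis using dead c by (auto simp: P_def)
        qed
      qed
      then show ?thesis using i by (auto simp: Q_def)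
    qed (use v in \<open>auto simp: Q_def pverts_G V_def blob_def\<close>)
  qed
  also have "card Q \<le> card (\<Union>i<6. P i) + (5 * N + (2 + L))"
  proof -
    have "card (hubs \<union> leaves) \<le> 2 + L"
      using card_Un_le[of hubs leaves] by (simp add: card_leaves hubs_def)
    moreover have "card (links \<union> (hubs \<union> leaves)) \<le> 5 * N + card (hubs \<union> leaves)"
      using card_Un_le[of links "hubs \<union> leaves"] by (simp add: card_links)
    moreover have "card Q \<le> card (\<Union>i<6. P i) + card (links \<union> (hubs \<union> leaves))"
      unfolding Q_def by (rule card_Un_le)
    ultimately show ?thesis by linarith
  qed
  also have "card (\<Union>i<6. P i) \<le> (\<Sum>i<6. card (P i))"
    by (rule card_UN_le) simp
  finally have *: "2 * num_components (delete_verts (with_proj G) X) \<le>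
    (\<Sum>i<6. 2 * card (P i)) + (10 * N + 2 * L + 4)"
    by (simp add: sum_distrib_left[symmetric])
  have "b - 26 \<le> (\<Sum>i<6. if dead i = {} then 0 else b - 26)"
    using member_le_sum[of i\<^sub>0 "{..<6}" "\<lambda>i. if dead i = {} then 0 else b - 26"] assms by simp
  then have "(\<Sum>i<6. 2 * card (P i)) + (b - 26) \<le>
      (\<Sum>i<6. 2 * card (P i) + (if dead i = {} then 0 else b - 26))"
    by (simp only: sum.distrib)
  also have "\<dots> \<le> (\<Sum>i<6. card (X \<inter> blob i) + 2)"
    by (intro sum_mono card_P)
  also have "\<dots> = card (\<Union>i<6. X \<inter> blob i) + 12"
    using finite_blob by (subst card_UN_disjoint) (auto simp: blob_def sum_Suc)
  also have "card (\<Union>i<6. X \<inter> blob i) \<le> card X"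
    using finite_X by (intro card_mono) auto
  finally have "(\<Sum>i<6. 2 * card (P i)) + (b - 26) \<le> card X + 12" by simp
  \<comment> \<open>The losses 10 N + 2 L + 4, 12 and 26 add up to exactly the left-hand side of
    \<open>b_ge\<close>.\<close>
  then show ?thesis using * b_ge by presburger
qed

section \<open>Cuts along the links when no class is dead\<close>

definition wire :: "nat \<Rightarrow> nat \<Rightarrow> vertex set" where
  "wire i n = {Link i n, Blob 0 (int i) n, Blob i (int i) n}"

lemma finite_wire: "finite (wire i n)"
  by (simp add: wire_def)

text \<open>Wires are pairwise disjoint and use only the classes 1 to 5, so they meet neither the
  hubs nor the bottleneck.\<close>

lemma card_wires:
  "(\<Sum>i=1..5. \<Sum>n<N. card (X \<inter> wire i n)) + card (X \<inter> hubs) \<le> card (X - bottleneck)"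
proof -
  let ?U = "\<Union>(i, n)\<in>{1..5} \<times> {..<N}. X \<inter> wire i n"
  have "card ?U = (\<Sum>(i, n)\<in>{1..5} \<times> {..<N}. card (X \<inter> wire i n))"
    by (subst card_UN_disjoint) (auto simp: finite_wire case_prod_unfold wire_def)
  moreover have "card (?U \<union> (X \<inter> hubs)) = card ?U + card (X \<inter> hubs)"
    by (intro card_Un_disjoint) (auto simp: finite_wire hubs_def wire_def)
  moreover have "card (?U \<union> (X \<inter> hubs)) \<le> card (X - bottleneck)"
    using finite_X by (intro card_mono) (auto simp: hubs_def wire_def bottleneck_def)
  ultimately show ?thesis by (simp add: sum.cartesian_product)
qed

lemma wire_cut_ge:
  assumes "i \<in> {1..5}" "\<And>n. n < N \<Longrightarrow> X \<inter> wire i n \<noteq> {}"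
  shows "N \<le> (\<Sum>n<N. card (X \<inter> wire i n))"
proof -
  have "1 \<le> card (X \<inter> wire i n)" if "n < N" for n
    using assms(2)[OF that] by (simp add: Suc_le_eq card_gt_0_iff finite_wire)
  then have "(\<Sum>n<N. 1) \<le> (\<Sum>n<N. card (X \<inter> wire i n))" by (intro sum_mono) auto
  then show ?thesis by simp
qed

lemma K_le_2: "K \<le> 2 * (L + 1)"
proof -
  have "K * N \<le> 2 * (L + 1) * N" using ratio by linarith
  then have "0 < N \<longrightarrow> K \<le> 2 * (L + 1)" by (simp only: mult_le_cancel2)
  then show ?thesis using N_ge by simp
qed

text \<open>
  The difference of the two sides is linear in \<open>m\<close>, hence it suffices to compare them at \<open>m = 0\<close> and
  at \<open>m = N\<close>.
\<close>
lemma cut_bound: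
  assumes "m \<le> N"
  shows "K * (1 + m) \<le> (L + 1) * (N + m)"
proof -
  have "0 \<le> (int N - int m) * (int (L + 1) * int N - int K)
      + int m * (int (L + 1) * 2 * int N - int K * (int N + 1))"
  proof (intro add_nonneg_nonneg mult_nonneg_nonneg)
    have "K \<le> (L + 1) * N"
      using K_le_2 mult_le_mono2[of 2 N "L + 1"] N_ge by simp
    then show "0 \<le> int (L + 1) * int N - int K"
      by (metis diff_ge_0_iff_ge of_nat_le_iff of_nat_mult)
    have "K * (N + 1) \<le> (L + 1) * 2 * N" using ratio K_le_2 by (simp add: algebra_simps)
    then have "int (K * (N + 1)) \<le> int ((L + 1) * 2 * N)" by (simp only: of_nat_le_iff)
    then show "0 \<le> int (L + 1) * 2 * int N - int K * (int N + 1)"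
      by (simp add: algebra_simps)
  qed (use assms in auto)
  also have "\<dots> = int N * (int ((L + 1) * (N + m)) - int (K * (1 + m)))"
    by (simp add: algebra_simps)
  finally have "0 \<le> int ((L + 1) * (N + m)) - int (K * (1 + m))"
    using N_ge by (simp add: zero_le_mult_iff)
  then show ?thesis by linarith
qed

text \<open>Blobs with a usable link hang on the hub; \<open>D\<close> collects the others. If
  \<open>D\<close> is nonempty, all wires of some bundle are cut, at a cost of at least 14, while at
  most 7 components arise. The cost is measured outside the bottleneck, whose deletion is reserved
  for paying for the leaves.\<close>

lemma cover_hub:
  assumes intact: "\<And>i. i < 6 \<Longrightarrow> dead i = {}"
    and hub: "Hub m \<in> V - X" and link: "Link k l \<in> V - X"
  shows "\<exists>P. finite P \<and> (\<forall>v\<in>V - X - leaves. \<exists>p\<in>P. conn v p) \<and>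
    (card P \<le> 1 \<or> K * card P \<le> (L + 1) * card (X - bottleneck))"
proof -
  define D where "D = {i. i < 6 \<and> \<not> (\<exists>i' n. Link i' n \<in> V - X \<and>
    Blob i (int i') n \<in> V - X \<and> (i = 0 \<or> i = i'))}"
  define P where "P = insert (Hub m) ((\<lambda>i. rep i 0) ` D)"
  have D: "D \<subseteq> {..<6}" by (auto simp: D_def)
  then have fin_D: "finite D" by (rule finite_subset) simp
  have link_hub: "conn (Link i n) (Hub m)" if "Link i n \<in> V - X" for i n
    using that hub by (intro conn_arrow) auto
  have "\<exists>p\<in>P. conn v p" if v: "v \<in> V - X - leaves" for v
  proof (cases v)
    case (Blob i c j)
    then have i: "i < 6" using v by simp
    have rep: "conn v (rep i 0)" using conn_rep_0 intact i v Blob by simp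
    show ?thesis
    proof (cases "i \<in> D")
      case True
      then show ?thesis using rep by (auto simp: P_def)
    next
      case False
      then obtain i' n where n: "Link i' n \<in> V - X" "Blob i (int i') n \<in> V - X" "i = 0 \<or> i = i'"
        using i by (auto simp: D_def)
      have "conn (Blob i (int i') n) (rep i 0)" using conn_rep_0 intact i n(2) by blast
      then have "conn (rep i 0) (Blob i (int i') n)" by (rule conn_sym)
      also have "conn (Blob i (int i') n) (Link i' n)" using n by (intro conn_arrow) auto
      also have "conn (Link i' n) (Hub m)" using n(1) by (rule link_hub)
      finally have "conn v (Hub m)" using rep by (rule rtrancl_trans[rotated])
      then show ?thesis by (auto simp: P_def)
    qed
  next
    case (Link i n)
    then show ?thesis using link_hub v by (auto simp: P_def)
  next
    case (Hub m')
    \<comment> \<open>The surviving link joins the other hub, if present, to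
      \<open>Hub m\<close>.\<close>
    then have "conn v (Link k l)" using v link by (intro conn_arrow) auto
    then have "conn v (Hub m)" using link_hub[OF link] by (rule rtrancl_trans)
    then show ?thesis by (auto simp: P_def)
  next
    case (Leaf m')
    then show ?thesis using v by (auto simp: leaves_def)
  qed
  moreover have "card P \<le> 1 \<or> K * card P \<le> (L + 1) * card (X - bottleneck)"
  proof (cases "D = {}")
    case True
    then show ?thesis by (simp add: P_def)
  next
    case False
    then obtain i where i: "i \<in> D" by blast
    \<comment> \<open>Blob \<open>0\<close> is attached to all bundles, so if it is cut off, bundle
      1 in particular is cut; an outer blob has only its own bundle.\<close>
    define i' where "i' = max 1 i"
    have i': "i' \<in> {1..5}" "i = 0 \<or> i = i'" using i by (auto simp: i'_def D_def)
    have "X \<inter> wire i' n \<noteq> {}" if "n < N" for n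
    proof -
      have "Link i' n \<in> V" "Blob i (int i') n \<in> V"
        using i i' that N_le by (auto simp: D_def)
      then have "Link i' n \<in> X \<or> Blob i (int i') n \<in> X"
        using i i'(2) by (auto simp: D_def)
      then show ?thesis using i'(2) by (auto simp: wire_def)
    qed
    then have "N \<le> (\<Sum>n<N. card (X \<inter> wire i' n))" using i' by (intro wire_cut_ge)
    also have "\<dots> \<le> (\<Sum>i=1..5. \<Sum>n<N. card (X \<inter> wire i n))"
      using i' member_le_sum[of i' "{1..5}" "\<lambda>i. \<Sum>n<N. card (X \<inter> wire i n)"] by simp
    also have "\<dots> \<le> card (X - bottleneck)" using card_wires by linarith
    finally have "14 \<le> card (X - bottleneck)" using N_ge by linarith
    moreover have "card P \<le> 7"
    proof -
      have "card D \<le> 6" using card_mono[OF _ D] by simp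
      moreover have "card ((\<lambda>i. rep i 0) ` D) \<le> card D" using fin_D by (rule card_image_le)
      ultimately show ?thesis using fin_D by (simp add: P_def card_insert_if)
    qed
    ultimately have "2 * card P \<le> card (X - bottleneck)" by linarith
    then have "(L + 1) * (2 * card P) \<le> (L + 1) * card (X - bottleneck)"
      by (rule mult_le_mono2)
    moreover have "K * card P \<le> 2 * (L + 1) * card P" using K_le_2 by (rule mult_le_mono1)
    ultimately show ?thesis by (simp add: mult_ac)
  qed
  moreover have "finite P" using fin_D by (simp add: P_def)
  ultimately show ?thesis by blast
qed

text \<open>Without links there are at most six blobs and two hubs, whereas deleting the five
  bundles costs at least 5 N, more than twice as much.\<close>

lemma cover_links:
  assumes intact: "\<And>i. i < 6 \<Longrightarrow> dead i = {}" and links: "links \<subseteq> X"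
  shows "\<exists>P. finite P \<and> (\<forall>v\<in>V - X - leaves. \<exists>p\<in>P. conn v p) \<and>
    (card P \<le> 1 \<or> K * card P \<le> (L + 1) * card (X - bottleneck))"
proof -
  define P where "P = (\<lambda>i. rep i 0) ` {..<6} \<union> hubs"
  have "\<exists>p\<in>P. conn v p" if v: "v \<in> V - X - leaves" for v
  proof (cases v)
    case (Blob i c j)
    then show ?thesis using conn_rep_0 intact v by (auto simp: P_def)
  next
    case (Hub m)
    then have "v \<in> P" using v by (auto simp: P_def hubs_def)
    then show ?thesis by blast
  qed (use v links in \<open>auto simp: leaves_def links_def\<close>)
  moreover have "K * card P \<le> (L + 1) * card (X - bottleneck)"
  proof -
    have "N \<le> (\<Sum>n<N. card (X \<inter> wire i n))" if "i \<in> {1..5}" for i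
    proof (rule wire_cut_ge[OF that])
      fix n assume "n < N"
      then have "Link i n \<in> X" using that links by (auto simp: links_def)
      then show "X \<inter> wire i n \<noteq> {}" by (auto simp: wire_def)
    qed
    then have "(\<Sum>i=1..5::nat. N) \<le> (\<Sum>i=1..5. \<Sum>n<N. card (X \<inter> wire i n))"
      by (intro sum_mono) auto
    then have "16 \<le> card (X - bottleneck)" using card_wires N_ge by simp
    moreover have "card P \<le> 8"
      using card_Un_le[of "(\<lambda>i. rep i 0) ` {..<6}" hubs] card_image_le[of "{..<6}" "\<lambda>i. rep i 0"]
      by (simp add: P_def hubs_def)
    ultimately have "2 * card P \<le> card (X - bottleneck)" by linarith
    then have "(L + 1) * (2 * card P) \<le> (L + 1) * card (X - bottleneck)"
      by (rule mult_le_mono2)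
    moreover have "K * card P \<le> 2 * (L + 1) * card P" using K_le_2 by (rule mult_le_mono1)
    ultimately show ?thesis by (simp add: mult_ac)
  qed
  moreover have "finite P" by (simp add: P_def hubs_def)
  ultimately show ?thesis by blast
qed

text \<open>\<open>D\<close> lists the bundles that are cut completely and \<open>I i\<close> the
  links that are isolated. An isolated link costs two deletions. A cut bundle costs one deletion per
  wire and a second one per isolated link, against 1 + |I i| components, which is the situation of
  \<open>cut_bound\<close>.\<close>

lemma cover_no_hub:
  assumes intact: "\<And>i. i < 6 \<Longrightarrow> dead i = {}" and hubs: "hubs \<subseteq> X"
  shows "\<exists>P. finite P \<and> (\<forall>v\<in>V - X - leaves. \<exists>p\<in>P. conn v p) \<and>
    (card P \<le> 1 \<or> K * card P \<le> (L + 1) * card (X - bottleneck))"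
proof -
  define D where "D = {i \<in> {1..5}. \<forall>n<N. X \<inter> wire i n \<noteq> {}}"
  define I where "I i = {n. n < N \<and> Link i n \<notin> X \<and> Blob 0 (int i) n \<in> X \<and> Blob i (int i) n \<in> X}"
    for i
  define P where "P = insert (rep 0 0)
    ((\<lambda>i. rep i 0) ` D \<union> (\<lambda>(i, n). Link i n) ` Sigma {1..5} I)"
  have I: "I i \<subseteq> {..<N}" for i by (auto simp: I_def)
  then have fin_I: "finite (I i)" for i by (rule finite_subset) simp
  have fin_D: "finite D" by (simp add: D_def)
  have blob: "\<exists>p\<in>P. conn (Blob i c j) p" if v: "Blob i c j \<in> V - X" for i c j
  proof -
    have i: "i < 6" using v by simp
    have rep: "conn (Blob i c j) (rep i 0)" using conn_rep_0 intact i v by simp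
    consider "i = 0" | "i \<in> D" | "i \<in> {1..5} - D" using i by force
    then show ?thesis
    proof cases
      case 3
      then obtain n where n: "n < N" "X \<inter> wire i n = {}" by (auto simp: D_def)
      then have live: "Link i n \<in> V - X" "Blob 0 (int i) n \<in> V - X" "Blob i (int i) n \<in> V - X"
        using 3 N_le by (auto simp: wire_def)
      have "conn (Blob i (int i) n) (rep i 0)" using conn_rep_0 intact i live by blast
      then have "conn (rep i 0) (Blob i (int i) n)" by (rule conn_sym)
      also have "conn (Blob i (int i) n) (Link i n)" using live by (intro conn_arrow) auto
      also have "conn (Link i n) (Blob 0 (int i) n)" using live by (intro conn_arrow) auto
      also have "conn (Blob 0 (int i) n) (rep 0 0)" using conn_rep_0 intact live by simp
      finally have "conn (Blob i c j) (rep 0 0)" using rep by (rule rtrancl_trans[rotated])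
      then show ?thesis by (auto simp: P_def)
    qed (use rep in \<open>auto simp: P_def\<close>)
  qed
  have "\<exists>p\<in>P. conn v p" if v: "v \<in> V - X - leaves" for v
  proof (cases v)
    case (Blob i c j)
    then show ?thesis using blob v by blast
  next
    case (Link i n)
    then have i: "i \<in> {1..5}" "n < N" "Link i n \<in> V - X" using v by auto
    show ?thesis
    proof (cases "n \<in> I i")
      case True
      then have "v \<in> P" using i Link by (auto simp: P_def)
      then show ?thesis by blast
    next
      case False
      then have "Blob 0 (int i) n \<in> V - X \<or> Blob i (int i) n \<in> V - X"
        using i N_le by (auto simp: I_def)
      then obtain i' where i': "i' = 0 \<or> i' = i" "Blob i' (int i) n \<in> V - X"
        by blast
      then have "conn v (Blob i' (int i) n)" using i Link by (intro conn_arrow) auto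
      then show ?thesis using blob[OF i'(2)] by (meson rtrancl_trans)
    qed
  qed (use v hubs in \<open>auto simp: leaves_def hubs_def less_2_cases_iff\<close>)
  moreover have "K * card P \<le> (L + 1) * card (X - bottleneck)"
  proof -
    have wire: "K * ((if i \<in> D then 1 else 0) + card (I i)) \<le>
        (L + 1) * (\<Sum>n<N. card (X \<inter> wire i n))" if i: "i \<in> {1..5}" for i
    proof -
      have two: "2 \<le> card (X \<inter> wire i n)" if "n \<in> I i" for n
      proof -
        have "card {Blob 0 (int i) n, Blob i (int i) n} \<le> card (X \<inter> wire i n)"
          using that finite_wire by (intro card_mono) (auto simp: I_def wire_def)
        then show ?thesis using i by simp
      qed
      have card_I: "(\<Sum>n<N. if n \<in> I i then 1 else 0) = card (I i)"
        using I[of i] by (simp add: sum.If_cases Int_absorb1)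
      show ?thesis
      proof (cases "i \<in> D")
        case True
        have "1 + (if n \<in> I i then 1 else 0) \<le> card (X \<inter> wire i n)" if "n < N" for n
        proof -
          have "X \<inter> wire i n \<noteq> {}" using True that by (simp add: D_def)
          then have "1 \<le> card (X \<inter> wire i n)" by (simp add: Suc_le_eq card_gt_0_iff finite_wire)
          then show ?thesis using two[of n] by (cases "n \<in> I i") auto
        qed
        then have "(\<Sum>n<N. 1 + (if n \<in> I i then 1 else 0)) \<le> (\<Sum>n<N. card (X \<inter> wire i n))"
          by (intro sum_mono) auto
        then have "N + card (I i) \<le> (\<Sum>n<N. card (X \<inter> wire i n))"
          using card_I by (simp add: sum_Suc)
        then have "(L + 1) * (N + card (I i)) \<le> (L + 1) * (\<Sum>n<N. card (X \<inter> wire i n))"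
          by (rule mult_le_mono2)
        moreover have "K * (1 + card (I i)) \<le> (L + 1) * (N + card (I i))"
          using card_mono[OF _ I] by (intro cut_bound) simp
        ultimately show ?thesis using True by simp
      next
        case False
        have "(\<Sum>n<N. 2 * (if n \<in> I i then 1 else 0)) \<le> (\<Sum>n<N. card (X \<inter> wire i n))"
          using two by (intro sum_mono) auto
        then have "2 * card (I i) \<le> (\<Sum>n<N. card (X \<inter> wire i n))"
          using card_I by (simp only: sum_distrib_left[symmetric])
        then have "(L + 1) * (2 * card (I i)) \<le> (L + 1) * (\<Sum>n<N. card (X \<inter> wire i n))"
          by (rule mult_le_mono2)
        moreover have "K * card (I i) \<le> 2 * (L + 1) * card (I i)"
          using K_le_2 by (rule mult_le_mono1)
        ultimately show ?thesis using False by (simp add: mult_ac)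
      qed
    qed
    have "card P \<le> 1 + (card D + (\<Sum>i=1..5. card (I i)))"
    proof -
      have "card ((\<lambda>(i, n). Link i n) ` Sigma {1..5} I) \<le> (\<Sum>i=1..5. card (I i))"
        using card_image_le[of "Sigma {1..5} I" "\<lambda>(i, n). Link i n"] fin_I by simp
      moreover have "card ((\<lambda>i. rep i 0) ` D) \<le> card D" using fin_D by (rule card_image_le)
      ultimately have "card ((\<lambda>i. rep i 0) ` D \<union> (\<lambda>(i, n). Link i n) ` Sigma {1..5} I) \<le>
          card D + (\<Sum>i=1..5. card (I i))"
        using card_Un_le[of "(\<lambda>i. rep i 0) ` D" "(\<lambda>(i, n). Link i n) ` Sigma {1..5} I"]
        by linarith
      then show ?thesis using fin_D fin_I by (simp add: P_def card_insert_if)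
    qed
    also have "card D = (\<Sum>i=1..5::nat. if i \<in> D then 1 else 0)"
    proof -
      have "D \<subseteq> {1..5}" by (auto simp: D_def)
      then show ?thesis by (simp add: sum.If_cases Int_absorb1)
    qed
    finally have "card P \<le> 1 + (\<Sum>i=1..5. (if i \<in> D then 1 else 0) + card (I i))"
      by (simp only: sum.distrib)
    then have "K * card P \<le> K * (1 + (\<Sum>i=1..5. (if i \<in> D then 1 else 0) + card (I i)))"
      by (rule mult_le_mono2)
    also have "\<dots> = K + (\<Sum>i=1..5. K * ((if i \<in> D then 1 else 0) + card (I i)))"
      by (simp only: distrib_left sum_distrib_left mult_1_right)
    \<comment> \<open>The component of the central blob is charged to the two deleted hubs.\<close>
    also have "\<dots> \<le> 2 * (L + 1) + (\<Sum>i=1..5. (L + 1) * (\<Sum>n<N. card (X \<inter> wire i n)))"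
      using wire by (intro add_mono K_le_2 sum_mono)
    also have "\<dots> = (L + 1) * ((\<Sum>i=1..5. \<Sum>n<N. card (X \<inter> wire i n)) + 2)"
      by (simp only: sum_distrib_left[symmetric]) (simp add: algebra_simps)
    also have "\<dots> \<le> (L + 1) * card (X - bottleneck)"
    proof (rule mult_le_mono2)
      have "card (X \<inter> hubs) = 2" using hubs by (simp add: Int_absorb1) (simp add: hubs_def)
      then show "(\<Sum>i=1..5. \<Sum>n<N. card (X \<inter> wire i n)) + 2 \<le> card (X - bottleneck)"
        using card_wires by simp
    qed
    finally show ?thesis .
  qed
  moreover have "finite P" using fin_D fin_I by (simp add: P_def)
  ultimately show ?thesis by blast
qed

text \<open>A dead class gives ratio 2, which is enough by \<open>K_le_2\<close>. Otherwise the
  three covers treat all vertices except the leaves, and the leaves are separated only by deleting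
  the whole bottleneck.\<close>

lemma num_components_bound:
  assumes "2 \<le> num_components (delete_verts (with_proj G) X)"
  shows "K * num_components (delete_verts (with_proj G) X) \<le> (L + 1) * card X"
proof (cases "\<exists>i<6. dead i \<noteq> {}")
  case True
  then have "2 * num_components (delete_verts (with_proj G) X) \<le> card X"
    using card_ge_if_dead by blast
  then have "(L + 1) * (2 * num_components (delete_verts (with_proj G) X)) \<le> (L + 1) * card X"
    by (rule mult_le_mono2)
  moreover have "K * num_components (delete_verts (with_proj G) X) \<le>
      2 * (L + 1) * num_components (delete_verts (with_proj G) X)"
    using K_le_2 by (rule mult_le_mono1)
  ultimately show ?thesis by (simp add: mult_ac)
next
  case False
  then have intact: "dead i = {}" if "i < 6" for i using that by blast
  have "\<exists>P. finite P \<and> (\<forall>v\<in>V - X - leaves. \<exists>p\<in>P. conn v p) \<and>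
    (card P \<le> 1 \<or> K * card P \<le> (L + 1) * card (X - bottleneck))"
  proof -
    consider "hubs \<subseteq> X" | "links \<subseteq> X"
      | m k l where "Hub m \<in> V - X" "Link k l \<in> V - X"
    proof (cases "hubs \<subseteq> X \<or> links \<subseteq> X")
      case False
      then obtain u w where "u \<in> hubs - X" "w \<in> links - X" by blast
      moreover from this obtain m k l where "u = Hub m" "w = Link k l"
        by (auto simp: hubs_def links_def)
      ultimately have "Hub m \<in> V - X" "Link k l \<in> V - X" by (auto simp: V_def)
      then show ?thesis by (rule that(3))
    qed (use that in blast)
    then show ?thesis
      using cover_no_hub[OF intact] cover_links[OF intact] cover_hub[OF intact] by cases blast+
  qed
  then obtain P where P: "finite P" "\<And>v. v \<in> V - X - leaves \<Longrightarrow> \<exists>p\<in>P. conn v p"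
    "card P \<le> 1 \<or> K * card P \<le> (L + 1) * card (X - bottleneck)"
    by blast
  show ?thesis
  proof (cases "bottleneck \<subseteq> X")
    case True
    have "num_components (delete_verts (with_proj G) X) \<le> card (P \<union> leaves)"
      using P(1,2) finite_leaves by (intro num_components_le[OF pair_graph_G])
        (auto simp: pverts_G)
    also have "\<dots> \<le> card P + L"
      using card_Un_le[of P leaves] by (simp add: card_leaves)
    finally have "K * num_components (delete_verts (with_proj G) X) \<le> K * (card P + L)"
      by (rule mult_le_mono2)
    \<comment> \<open>If the rest forms one component, it and the leaves are charged to the
      bottleneck alone, the extremal situation. Otherwise the rest is charged to the deletions
      outside the bottleneck.\<close>
    also have "\<dots> \<le> (L + 1) * card (X - bottleneck) + (L + 1) * K"
    proof (cases "card P \<le> 1")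
      case True
      then have "K * (card P + L) \<le> K * (L + 1)" by (intro mult_le_mono2) simp
      then show ?thesis by (simp add: mult.commute)
    qed (use P(3) in \<open>simp add: algebra_simps\<close>)
    also have "\<dots> = (L + 1) * card X"
    proof -
      have "card bottleneck = K" by (simp add: bottleneck_def card_image inj_on_def)
      then have "card X = card (X - bottleneck) + K"
        using True finite_X card_mono[OF finite_X True] by (simp add: card_Diff_subset finite_subset)
      then show ?thesis by (simp add: algebra_simps)
    qed
    finally show ?thesis .
  next
    case False
    then obtain j where j: "j < K" "Blob 0 0 j \<notin> X" by (auto simp: bottleneck_def)
    then have j': "Blob 0 0 j \<in> V - X - leaves" using K_le by (auto simp: leaves_def)
    have le: "num_components (delete_verts (with_proj G) X) \<le> card P"
    proof (rule num_components_le[OF pair_graph_G P(1)])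
      fix v assume v: "v \<in> pverts G - X"
      show "\<exists>p\<in>P. conn v p"
      proof (cases "v \<in> leaves")
        case True
        then have "conn v (Blob 0 0 j)" using v j j'
          by (intro conn_arrow) (auto simp: leaves_def pverts_G)
        then show ?thesis using P(2)[OF j'] by (meson rtrancl_trans)
      qed (use P(2) v in \<open>auto simp: pverts_G\<close>)
    qed
    then have "K * num_components (delete_verts (with_proj G) X) \<le> K * card P"
      by (rule mult_le_mono2)
    \<comment> \<open>All leaves hang on the surviving bottleneck vertex, so \<open>P\<close> covers
      everything; having two components excludes \<open>card P \<le> 1\<close>.\<close>
    also have "\<dots> \<le> (L + 1) * card (X - bottleneck)" using P(3) le assms by linarith
    also have "\<dots> \<le> (L + 1) * card X"
      using finite_X by (intro mult_le_mono2 card_mono) auto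
    finally show ?thesis .
  qed
qed

end

section \<open>The bottleneck attains the bound\<close>

lemma num_components_bottleneck: "L + 1 \<le> num_components (delete_verts (with_proj G) bottleneck)"
proof -
  \<comment> \<open>Each leaf gets its own value, and everything else gets 0. The only neighbours of
    leaves are deleted, so \<open>g\<close> is constant on live arcs.\<close>
  define g where "g v = (case v of Leaf m \<Rightarrow> Suc m | _ \<Rightarrow> 0)" for v
  have "g u = g v" if "(u, v) \<in> live_arcs G bottleneck" for u v
    using that by (cases u; cases v) (auto simp: live_arcs_def arc_iff g_def bottleneck_def)
  then have "card (g ` (pverts G - bottleneck)) \<le>
      num_components (delete_verts (with_proj G) bottleneck)"
    by (rule num_components_ge[OF pair_graph_G])
  moreover have "{..L} \<subseteq> g ` (pverts G - bottleneck)"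
  proof
    fix m assume m: "m \<in> {..L}"
    show "m \<in> g ` (pverts G - bottleneck)"
    proof (cases m)
      case 0
      then show ?thesis
        by (intro image_eqI[of _ _ "Hub 0"]) (auto simp: pverts_G bottleneck_def g_def)
    next
      case (Suc m')
      then show ?thesis using m
        by (intro image_eqI[of _ _ "Leaf m'"]) (auto simp: pverts_G bottleneck_def g_def)
    qed
  qed
  then have "card {..L} \<le> card (g ` (pverts G - bottleneck))"
    using finite_V by (intro card_mono) (auto simp: pverts_G)
  ultimately show ?thesis by simp
qed

lemma toughness_G:
  assumes "1 \<le> L"
  shows "toughness (with_proj G) = ereal (real K / real (L + 1))"
proof (rule toughness_eqI)
  show "tough (real K / real (L + 1)) (with_proj G)"
    unfolding tough_def
  proof (intro allI impI)
    fix S assume S: "S \<subseteq> verts (with_proj G)"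
      "2 \<le> num_components (delete_verts (with_proj G) S)"
    then have "K * num_components (delete_verts (with_proj G) S) \<le> (L + 1) * card S"
      by (intro num_components_bound) (auto simp: pverts_G)
    then have "real K * real (num_components (delete_verts (with_proj G) S)) \<le>
        real (L + 1) * real (card S)"
      by (metis of_nat_le_iff of_nat_mult)
    then show "real K / real (L + 1) * real (num_components (delete_verts (with_proj G) S)) \<le>
        real (card S)"
      by (simp add: field_simps)
  qed
  show "bottleneck \<subseteq> verts (with_proj G)"
    using K_le by (auto simp: bottleneck_def pverts_G)
  show "2 \<le> num_components (delete_verts (with_proj G) bottleneck)"
    using num_components_bottleneck assms by linarith
  have "real K = real K / real (L + 1) * real (L + 1)" by simp
  also have "\<dots> \<le> real K / real (L + 1) * real (num_components (delete_verts (with_proj G) bottleneck))"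
    using num_components_bottleneck by (intro mult_left_mono) (simp_all only: of_nat_le_iff, simp)
  finally show "real (card bottleneck) \<le> \<dots>"
    by (simp add: bottleneck_def card_image inj_on_def)
qed (simp_all add: not_complete_G)

end

section \<open>Choice of parameters and the final graph\<close>

lemma gadget_parameters:
  fixes q :: nat
  assumes "q \<ge> 6"
  shows "gadget (4 * q + 1) (2 * q\<^sup>2 - q - 2) (q\<^sup>2 + q - 1) (20 * q\<^sup>2 + 50 * q + 100)"
proof -
  \<comment> \<open>This makes the truncated subtractions in the parameters exact.\<close>
  have q2: "6 * q \<le> q\<^sup>2" using assms by (simp add: power2_eq_square)
  define k l where "k = 2 * q\<^sup>2 - q - 2" and "l = q\<^sup>2 + q - 1"
  have k: "k + q + 2 = 2 * q\<^sup>2" and l: "l + 1 = q\<^sup>2 + q"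
    using q2 assms unfolding k_def l_def by linarith+
  have ratio: "2 * (l + 1) + k * (4 * q + 1) \<le> 2 * (l + 1) * (4 * q + 1)"
  proof -
    have "2 * (l + 1) = k + (3 * q + 2)" using k l by simp
    \<comment> \<open>The deficit 2 (l + 1) - k is 3 q + 2, so \<open>ratio\<close> amounts to 2
      (q^2 + q) \<le> (3 q + 2) N, which the odd number N = 4 q + 1 satisfies.\<close>
    moreover have "2 * (l + 1) \<le> (3 * q + 2) * (4 * q + 1)"
      unfolding l by (simp add: algebra_simps power2_eq_square)
    ultimately show ?thesis by (simp only: distrib_right)
  qed
  have "gadget (4 * q + 1) k l (20 * q\<^sup>2 + 50 * q + 100)"
  proof
    show "2 * (l + 1) + k * (4 * q + 1) \<le> 2 * (l + 1) * (4 * q + 1)" by (rule ratio)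
  qed (use k l q2 assms in simp_all)
  then show ?thesis by (simp only: k_def l_def)
qed

theorem theorem1p1:
  fixes q :: nat
  assumes "even q" and "q \<ge> 6"
  shows "\<exists>G :: nat pair_pre_digraph.
           pair_graph G \<and>
           triangle_free (with_proj G) \<and>
           \<not> (\<exists>H. two_factor H (with_proj G)) \<and>
           toughness (with_proj G) =
             ereal ((2 * (real q)^2 - real q - 2) / ((real q)^2 + real q)) \<and>
           (2 * (real q)^2 - real q - 2) / ((real q)^2 + real q) =
             2 - (3 * real q + 2) / ((real q)^2 + real q)"
proof -
  define N K L b where "N = 4 * q + 1" and "K = 2 * q\<^sup>2 - q - 2" and "L = q\<^sup>2 + q - 1"
    and "b = 20 * q\<^sup>2 + 50 * q + 100"
  interpret gadget N K L b
    unfolding N_def K_def L_def b_def using assms(2) by (rule gadget_parameters)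
  define G' where "G' = relabel to_nat G"
  have q2: "6 * q \<le> q\<^sup>2" using assms(2) by (simp add: power2_eq_square)
  have "K + q + 2 = 2 * q\<^sup>2" "L + 1 = q\<^sup>2 + q"
    using q2 assms(2) unfolding K_def L_def by linarith+
  then have "real (K + q + 2) = real (2 * q\<^sup>2)" "real (L + 1) = real (q\<^sup>2 + q)"
    by (simp_all only:)
  then have K: "real K = 2 * (real q)\<^sup>2 - real q - 2" and L: "real (L + 1) = (real q)\<^sup>2 + real q"
    by simp_all
  have pos: "(real q)\<^sup>2 + real q > 0" using assms(2) by (intro add_nonneg_pos) auto
  show ?thesis
  proof (intro exI[of _ G'] conjI)
    show "pair_graph G'"
      unfolding G'_def by (rule pair_graph_relabel[OF inj_to_nat pair_graph_G])
    show "triangle_free (with_proj G')"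
      unfolding G'_def by (rule triangle_free_relabel[OF inj_to_nat pair_graph_G triangle_free_G])
    show "\<not> (\<exists>H. two_factor H (with_proj G'))"
    proof
      assume "\<exists>H. two_factor H (with_proj G')"
      then obtain H where H: "two_factor H (with_proj G')" by blast
      \<comment> \<open>The 2-factor is pulled back to the original vertices; the injective encoding
        preserves degrees.\<close>
      define F where "F = {(u :: vertex, v :: vertex). (to_nat u, to_nat v) \<in> arcs H}"
      show False
      proof (rule no_two_factor_G)
        show "F \<subseteq> parcs G"
          using two_factor_arcs(1)[OF H] relabel_arc_iff[OF inj_to_nat pair_graph_G]
          by (auto simp: F_def G'_def)
        show "sym F"
          using two_factor_arcs(2)[OF H] by (auto simp: F_def sym_def)
        fix v assume "v \<in> V"
        then have "card (arcs H `` {to_nat v}) = 2"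
          by (intro two_factor_arcs(3)[OF H]) (simp add: G'_def relabel_def pverts_G)
        moreover have "arcs H `` {to_nat v} = to_nat ` (F `` {v})"
          using two_factor_arcs(1)[OF H] by (auto simp: F_def G'_def relabel_def)
        ultimately show "card (F `` {v}) = 2" by (simp add: card_image)
      qed
    qed
    have "1 \<le> L" using assms(2) by (simp add: L_def)
    then show "toughness (with_proj G') =
        ereal ((2 * (real q)^2 - real q - 2) / ((real q)^2 + real q))"
      unfolding G'_def toughness_relabel[OF inj_to_nat pair_graph_G] K[symmetric] L[symmetric]
      by (rule toughness_G)
    show "(2 * (real q)^2 - real q - 2) / ((real q)^2 + real q) =
        2 - (3 * real q + 2) / ((real q)^2 + real q)"
      using pos by (simp add: field_simps)
  qed
qed

end
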